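(* Let $\mathbf{A}=\mathbf{A}^{\forall}+\mathbf{A}^{\exists}\in\mathbb{IR}^{n\times n}$ be a quantified square interval matrix, let $A^{\exists}_{v}$, $v\in V$, be all the vertex matrices of $\mathbf{A}^{\exists}$ ($V$ a finite index set), and let $e=(1,\dots,1)^T\in\mathbb{R}^n$. Then $\mathbf{A}$ is not AE regular if and only if there is $A^{\forall}\in\mathbf{A}^{\forall}$ for which the system $$(A^{\forall}+A^{\exists}_{v})x_{v}=0,\qquad [-e,e]^Tx_{v}=1,\qquad v\in V,$$ in the unknown vectors $x_v\in\mathbb{R}^n$, $v\in V$ (with the same matrix $A^{\forall}$ for all $v\in V$), is solvable.
   Context: An interval matrix is a set $\mathbf{A}=\{A\in\mathbb{R}^{m\times n} : \underline{A}\le A\le\overline{A}\}$, where $\underline{A}\le\overline{A}$ are given real matrices and inequalities are entrywise; $\mathbb{IR}^{m\times n}$ is the set of all $m\times n$ interval matrices. In a quantified interval matrix each interval entry is associated with either the universal or the existential quantifier, and $\mathbf{A}$ is split disjointly as $\mathbf{A}=\mathbf{A}^{\forall}+\mathbf{A}^{\exists}$: for each position $(i,j)$, the entry $\mathbf{a}_{ij}$ is put into $\mathbf{A}^{\forall}$ if it is universally quantified and into $\mathbf{A}^{\exists}$ if it is existentially quantified, the corresponding entry of the other matrix being $0$. $\mathbf{A}$ is AE regular if for every $A^{\forall}\in\mathbf{A}^{\forall}$ there is $A^{\exists}\in\mathbf{A}^{\exists}$ such that $A^{\forall}+A^{\exists}$ is nonsingular. A vertex matrix of an interval matrix $\mathbf{M}$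 is any $M\in\mathbf{M}$ with $m_{ij}\in\{\underline{m}_{ij},\overline{m}_{ij}\}$ for all $i,j$. $[-e,e]$ is the interval vector $\{f\in\mathbb{R}^n : -e\le f\le e\}$. An interval equation is solved by a vector if the vector solves some realization of it; thus the system is solvable for a given $A^{\forall}$ if there are vectors $x_v\in\mathbb{R}^n$ and $f_v\in[-e,e]$, $v\in V$, such that $(A^{\forall}+A^{\exists}_{v})x_{v}=0$ and $f_v^Tx_v=1$ for all $v\in V$. *)

theory Defs
  imports "HOL-Analysis.Analysis"
begin

text \<open>
  The order on \<^typ>\<open>real^'n^'m\<close> is the entrywise one, so the interval matrix with
  bounds \<open>L \<le> U\<close> is the set \<open>{L..U}\<close>, and the interval vector with bounds
  \<open>a \<le> b\<close> is \<open>{a..b}\<close>.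
\<close>

datatype quantifier = Universal | Existential

definition quantified_entries ::
    "quantifier \<Rightarrow> ('m \<Rightarrow> 'n \<Rightarrow> quantifier) \<Rightarrow> real^'n^'m \<Rightarrow> real^'n^'m" where
  "quantified_entries q Q M = (\<chi> i j. if Q i j = q then M $ i $ j else 0)"

definition forall_part ::
    "('m \<Rightarrow> 'n \<Rightarrow> quantifier) \<Rightarrow> real^'n^'m \<Rightarrow> real^'n^'m \<Rightarrow> (real^'n^'m) set" where
  "forall_part Q L U = {quantified_entries Universal Q L .. quantified_entries Universal Q U}"

definition exists_part ::
    "('m \<Rightarrow> 'n \<Rightarrow> quantifier) \<Rightarrow> real^'n^'m \<Rightarrow> real^'n^'m \<Rightarrow> (real^'n^'m) set" where
  "exists_part Q L U = {quantified_entries Existential Q L .. quantified_entries Existential Q U}"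

lemma interval_matrix_split:
  fixes L U :: "real^'n^'m"
  assumes "L \<le> U"
  shows "{L..U} = {A + B | A B. A \<in> forall_part Q L U \<and> B \<in> exists_part Q L U}"
proof (intro equalityI subsetI)
  fix M assume M: "M \<in> {L..U}"
  have q: "(Q i j = Existential) = (Q i j \<noteq> Universal)" for i j
    by (cases "Q i j") auto
  have "M = quantified_entries Universal Q M + quantified_entries Existential Q M"
    by (simp add: vec_eq_iff quantified_entries_def q)
  moreover have "quantified_entries Universal Q M \<in> forall_part Q L U"
    and "quantified_entries Existential Q M \<in> exists_part Q L U"
    using M by (auto simp: forall_part_def exists_part_def quantified_entries_def less_eq_vec_def)
  ultimately show "M \<in> {A + B | A B. A \<in> forall_part Q L U \<and> B \<in> exists_part Q L U}"
    by blast
next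
  fix M assume "M \<in> {A + B | A B. A \<in> forall_part Q L U \<and> B \<in> exists_part Q L U}"
  then obtain A B where M: "M = A + B"
    and A: "A \<in> forall_part Q L U" and B: "B \<in> exists_part Q L U" by blast
  have "L $ i $ j \<le> M $ i $ j \<and> M $ i $ j \<le> U $ i $ j" for i j
  proof -
    have "quantified_entries Universal Q L $ i $ j \<le> A $ i $ j
        \<and> A $ i $ j \<le> quantified_entries Universal Q U $ i $ j"
      and "quantified_entries Existential Q L $ i $ j \<le> B $ i $ j
        \<and> B $ i $ j \<le> quantified_entries Existential Q U $ i $ j"
      using A B by (simp_all add: forall_part_def exists_part_def less_eq_vec_def)
    then show ?thesis
      by (cases "Q i j") (simp_all add: M quantified_entries_def)
  qed
  then show "M \<in> {L..U}" by (simp add: less_eq_vec_def)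
qed

definition AE_regular ::
    "('n \<Rightarrow> 'n \<Rightarrow> quantifier) \<Rightarrow> real^'n^'n \<Rightarrow> real^'n^'n \<Rightarrow> bool" where
  "AE_regular Q L U \<longleftrightarrow>
     (\<forall>A \<in> forall_part Q L U. \<exists>B \<in> exists_part Q L U. invertible (A + B))"

definition vertex_matrices :: "real^'n^'m \<Rightarrow> real^'n^'m \<Rightarrow> (real^'n^'m) set" where
  "vertex_matrices L U = {M \<in> {L..U}. \<forall>i j. M $ i $ j \<in> {L $ i $ j, U $ i $ j}}"

definition exists_vertex_matrices ::
    "('m \<Rightarrow> 'n \<Rightarrow> quantifier) \<Rightarrow> real^'n^'m \<Rightarrow> real^'n^'m \<Rightarrow> (real^'n^'m) set" where
  "exists_vertex_matrices Q L U =
     vertex_matrices (quantified_entries Existential Q L) (quantified_entries Existential Q U)"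

definition ones :: "real^'n" where
  "ones = (\<chi> i. 1)"

text \<open>
  An interval equation is solved by a vector if the vector solves some realization of it,
  so each equation \<open>[-e,e]\<^sup>T x\<^sub>v = 1\<close> comes with its own choice of \<open>f\<^sub>v \<in> [-e,e]\<close>.
\<close>

definition system_solvable ::
    "real^'n^'n \<Rightarrow> 'v set \<Rightarrow> ('v \<Rightarrow> real^'n^'n) \<Rightarrow> bool" where
  "system_solvable A V B \<longleftrightarrow>
     (\<exists>(x :: 'v \<Rightarrow> real^'n) (f :: 'v \<Rightarrow> real^'n). \<forall>v\<in>V.
        f v \<in> {- ones..ones} \<and> (A + B v) *v x v = 0 \<and> f v \<bullet> x v = 1)"

end

theory Submission
  imports Defs
begin

text \<open>
  The determinant is affine in each single entry, so if it vanishes at all vertices of a box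
  of matrices, it vanishes on the whole box. Hence an existential part contains a matrix that
  makes the sum nonsingular iff one of its vertices does. The system states that every vertex
  fails: a nonzero kernel vector can be scaled so that one of its entries is \<open>1\<close>, and then
  the corresponding unit vector is an admissible \<open>f\<^sub>v\<close>.
\<close>

lemma not_invertible_iff_kernel:
  fixes A :: "real^'n^'n"
  shows "\<not> invertible A \<longleftrightarrow> (\<exists>x. x \<noteq> 0 \<and> A *v x = 0)"
  by (auto simp: invertible_left_inverse matrix_left_invertible_ker)

text \<open>For \<open>f\<close> in the box, \<open>f \<bullet> x\<close> attains 1 iff the absolute
  entries of \<open>x\<close> sum to at least 1. Kernel vectors can be scaled freely, so this only
  demands \<open>x \<noteq> 0\<close>.\<close>

lemma not_invertible_iff_normalized_kernel:
  fixes A :: "real^'n^'n"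
  shows "\<not> invertible A \<longleftrightarrow> (\<exists>x f. f \<in> {- ones..ones} \<and> A *v x = 0 \<and> f \<bullet> x = 1)"
proof
  assume "\<not> invertible A"
  then obtain x where "x \<noteq> 0" and Ax: "A *v x = 0"
    by (auto simp: not_invertible_iff_kernel)
  then obtain k where k: "x $ k \<noteq> 0"
    by (auto simp: vec_eq_iff)
  have "axis k 1 \<in> {- ones..ones :: real^'n}"
    by (simp add: less_eq_vec_def ones_def axis_def)
  moreover have "A *v (inverse (x $ k) *\<^sub>R x) = 0"
    by (simp add: matrix_vector_mult_scaleR Ax)
  moreover have "axis k 1 \<bullet> (inverse (x $ k) *\<^sub>R x) = 1"
    using k by (simp add: inner_axis')
  ultimately show "\<exists>x f. f \<in> {- ones..ones} \<and> A *v x = 0 \<and> f \<bullet> x = 1"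
    by blast
next
  assume "\<exists>x f. f \<in> {- ones..ones :: real^'n} \<and> A *v x = 0 \<and> f \<bullet> x = 1"
  then obtain x f where "A *v x = 0" "f \<bullet> x = 1" by blast
  moreover have "x \<noteq> 0" using \<open>f \<bullet> x = 1\<close> by auto
  ultimately show "\<not> invertible A"
    by (auto simp: not_invertible_iff_kernel)
qed

text \<open>Multilinearity of \<open>det\<close> in row \<open>i\<close>, in the form needed for a
  row on the segment between \<open>a\<close> and \<open>b\<close>.\<close>

lemma det_row_convex:
  fixes A :: "'a::comm_ring_1^'n^'n"
  assumes "A $ i = s *s a + t *s b"
  shows "det A = s * det (\<chi> k. if k = i then a else A $ k)
    + t * det (\<chi> k. if k = i then b else A $ k)"
proof -
  have "A = (\<chi> k. if k = i then s *s a + t *s b else A $ k)"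
    using assms by (auto simp: vec_eq_iff)
  then have "det A = det (\<chi> k. if k = i then s *s a + t *s b else A $ k)"
    by (rule arg_cong)
  also have "\<dots> = s * det (\<chi> k. if k = i then a else A $ k)
      + t * det (\<chi> k. if k = i then b else A $ k)"
    by (simp only: det_row_add[of i "\<lambda>k. s *s a" "\<lambda>k. t *s b" "\<lambda>k. A $ k"]
        det_row_mul[of i s "\<lambda>k. a" "\<lambda>k. A $ k"] det_row_mul[of i t "\<lambda>k. b" "\<lambda>k. A $ k"])
  finally show ?thesis .
qed

lemma invertible_entry_at_endpoint:
  fixes A M :: "real^'n^'n"
  assumes "invertible (A + M)" and "l \<le> M $ i $ j" and "M $ i $ j \<le> u"
  obtains c where "c \<in> {l, u}"
    and "invertible (A + (\<chi> p q. if p = i \<and> q = j then c else M $ p $ q))"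
proof -
  define E where "E c = (\<chi> p q. if p = i \<and> q = j then c else M $ p $ q)" for c
  obtain t where t: "M $ i $ j = (1 - t) * l + t * u"
  proof -
    have "M $ i $ j \<in> closed_segment l u"
      using assms(2,3) by (simp add: closed_segment_eq_real_ivl)
    then show thesis
      using that by (auto simp: in_segment)
  qed
  \<comment> \<open>Away from column \<open>j\<close> the three rows agree, and the weights sum to
    1; in column \<open>j\<close> this is the choice of \<open>t\<close>.\<close>
  have row: "(A + M) $ i = (1 - t) *s (A + E l) $ i + t *s (A + E u) $ i"
    by (auto simp: vec_eq_iff E_def t algebra_simps)
  have E: "(\<chi> k. if k = i then (A + E c) $ i else (A + M) $ k) = A + E c" for c
    by (auto simp: vec_eq_iff E_def)
  have "det (A + M) = (1 - t) * det (A + E l) + t * det (A + E u)"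
    using det_row_convex[OF row] unfolding E .
  then have "det (A + E l) \<noteq> 0 \<or> det (A + E u) \<noteq> 0"
    using assms(1) by (auto simp: invertible_det_nz)
  then show thesis
    using that unfolding E_def invertible_det_nz by blast
qed

lemma vertex_matrices_subset: "vertex_matrices L U \<subseteq> {L..U}"
  by (auto simp: vertex_matrices_def)

text \<open>Entries are pushed to an endpoint one at a time, each time keeping the sum with
  \<open>A\<close> invertible.\<close>

lemma invertible_at_vertex:
  fixes A M L U :: "real^'n^'n"
  assumes "M \<in> {L..U}" and "invertible (A + M)"
  obtains N where "N \<in> vertex_matrices L U" and "invertible (A + N)"
proof -
  \<comment> \<open>\<open>S\<close> collects the positions whose entries may still lie strictly
    between the bounds. \<open>M\<close> changes at each step of the induction, so it is
    generalized.\<close>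
  have "\<exists>N \<in> vertex_matrices L U. invertible (A + N)"
    if "finite S" "M \<in> {L..U}" "invertible (A + M)"
      "\<And>i j. (i, j) \<notin> S \<Longrightarrow> M $ i $ j \<in> {L $ i $ j, U $ i $ j}"
    for S :: "('n \<times> 'n) set" and M
    using that
  proof (induction S arbitrary: M rule: finite_induct)
    case empty
    then show ?case
      by (auto simp: vertex_matrices_def)
  next
    case (insert p S)
    obtain i j where p: "p = (i, j)" by force
    have LU: "L $ k $ l \<le> M $ k $ l" "M $ k $ l \<le> U $ k $ l" for k l
      using insert.prems(1) by (auto simp: less_eq_vec_def)
    obtain c where c: "c \<in> {L $ i $ j, U $ i $ j}"
      and inv: "invertible (A + (\<chi> p q. if p = i \<and> q = j then c else M $ p $ q))"
      using invertible_entry_at_endpoint[OF insert.prems(2) LU] by blast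
    have "L $ i $ j \<le> U $ i $ j"
      using LU order_trans by blast
    then have "(\<chi> p q. if p = i \<and> q = j then c else M $ p $ q) \<in> {L..U}"
      using c LU by (auto simp: less_eq_vec_def)
    \<comment> \<open>The modified matrix has an endpoint at \<open>p\<close> and agrees with
      \<open>M\<close> elsewhere, so only positions in \<open>S\<close> remain open.\<close>
    then show ?case
      by (rule insert.IH[OF _ inv]) (use c insert.prems(3) p in auto)
  qed
  from this[of UNIV, OF _ assms] that show thesis by auto
qed

theorem theorem4:
  fixes L U :: "real^'n^'n"
    and Q :: "'n \<Rightarrow> 'n \<Rightarrow> quantifier"
    and V :: "'v set"
    and B :: "'v \<Rightarrow> real^'n^'n"
  assumes "L \<le> U"
    and "finite V"
    and "B ` V = exists_vertex_matrices Q L U"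
  shows "\<not> AE_regular Q L U \<longleftrightarrow> (\<exists>A \<in> forall_part Q L U. system_solvable A V B)"
proof -
  have "(\<exists>M \<in> exists_part Q L U. invertible (A + M))
      \<longleftrightarrow> (\<exists>N \<in> exists_vertex_matrices Q L U. invertible (A + N))" for A
    unfolding exists_part_def exists_vertex_matrices_def
    by (meson invertible_at_vertex vertex_matrices_subset subsetD)
  then have "(\<exists>M \<in> exists_part Q L U. invertible (A + M))
      \<longleftrightarrow> (\<exists>v\<in>V. invertible (A + B v))" for A
    by (simp flip: assms(3))
  \<comment> \<open>Once \<open>A\<close> is fixed, the equations for different \<open>v\<close> are
    independent: choosing \<open>x\<close> and \<open>f\<close> for each \<open>v\<close> separately
    yields the functions required.\<close>
  moreover have "system_solvable A V B \<longleftrightarrow> (\<forall>v\<in>V. \<not> invertible (A + B v))" for A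
    unfolding system_solvable_def not_invertible_iff_normalized_kernel by metis
  ultimately show ?thesis
    by (simp add: AE_regular_def)
qed

end
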